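(* Let $p$ be a program of the language $\mathcal{W}$ (defined in the context) all of whose executions terminate. Let $E$ be any execution of $p$ and let $M$ be any execution-interpretation of $E$, in which the trace variable $tr$ is interpreted as the trace of $E$. Then every trace axiom $[\![ \mathtt{s} ]\!]$ of trace logic, as it occurs in the formula $[\![ p ]\!]$, holds in $M$; in particular $M \vDash [\![ p ]\!]$, where for $p = \texttt{func main\{}\mathtt{s_1};\dots;\mathtt{s_k}\texttt{\}}$ we set $[\![ p ]\!] := \bigwedge_{i=1}^k [\![ \mathtt{s_i} ]\!]$.
   Context: \textbf{Programs.} A program of $\mathcal{W}$ has the form $\texttt{func main\{}\mathtt{s_1};\dots;\mathtt{s_k}\texttt{\}}$ over a finite set $S_V$ of integer variables and integer-array variables, with side-effect-free integer/boolean expressions. Statements are: $\texttt{skip}$; integer assignments $\mathtt{v = e}$; array assignments $\mathtt{a[e_1] = e_2}$; conditionals $\texttt{if(Cond)\{}\mathtt{s_1};\dots;\mathtt{s_k}\texttt{\} else \{}\mathtt{s'_1};\dots;\mathtt{s'_{k'}}\texttt{\}}$; loops $\texttt{while(Cond)\{}\mathtt{s_1};\dots;\mathtt{s_k}\texttt{\}}$, arbitrarily nested. The while-statements in which a statement $\mathtt{s}$ is nested are its enclosing loops. \textbf{Operational semantics.} A state $\sigma$ maps each integer variable $\mathtt v$ to $\sigma(\mathtt v)\in\mathbb{Z}$ and each array variable $\mathtt a$ and $pos\in\mathbb Z$ to $\sigma(\mathtt a,pos)\in\mathbb Z$. A configuration is $\langle q,\sigma\rangle$ with $q$ a continuation (a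 sequence of statements ending in the marker $end$); while-statements in continuations carry a counter $i\in\mathbb N$, written $\texttt{while}^i$. Steps: $\langle \texttt{skip};q,\sigma\rangle\to\langle q,\sigma\rangle$; $\langle \mathtt{v=e};q,\sigma\rangle\to\langle q,\sigma[\mathtt v\mapsto [\![ \mathtt e]\!](\sigma)]\rangle$; $\langle \mathtt{a[e_1]=e_2};q,\sigma\rangle\to\langle q,\sigma[(\mathtt a,[\![\mathtt{e_1}]\!](\sigma))\mapsto[\![\mathtt{e_2}]\!](\sigma)]\rangle$; $\langle\texttt{if}(c)\{q_1\}\texttt{else}\{q_2\};q,\sigma\rangle\to\langle q_1;q,\sigma\rangle$ if $[\![c]\!](\sigma)$ is true and $\to\langle q_2;q,\sigma\rangle$ otherwise; $\langle \texttt{while}^i(c)\{q_1\};q,\sigma\rangle\to\langle q_1;\texttt{while}^{i+1}(c)\{q_1\};q,\sigma\rangle$ if $[\![c]\!](\sigma)$ is true and $\to\langle q,\sigma\rangle$ otherwise. An execution of $p$ is a finite sequence of such steps from an initial configuration $\langle p',\sigma_0\rangle$ (where $p'$ is $p$ with every loop annotated with counter $0$ and $\sigma_0$ arbitrary) to some $\langle end,\sigma\rangle$. \textbf{Trace logic.} Many-sorted first-order logic with equality $\simeq$, sorts $\mathbb N$ (naturals with $0,\mathrm{succ},\mathrm{pred},<$), $\mathbb I$ (integers with $0,1,\dots,+,*,<$), $\mathbb L$ (timepoints), $\mathbb T$ (traces). Each while-statement $\mathtt w$ has its own variable $it^{\mathtt w}$ of sort $\mathbb N$. For each statement $\mathtt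 s$ with enclosing loops $\mathtt{w_1},\dots,\mathtt{w_k}$ there is a symbol $l_s$ of target sort $\mathbb L$ with $k$ arguments of sort $\mathbb N$ (with $k+1$ if $\mathtt s$ is a while-statement); for each while-statement $\mathtt s$ also a symbol $n_s:\mathbb N^k\to\mathbb N$; and a constant $l_{end}$ of sort $\mathbb L$. Define $tp_{\mathtt s}:=l_s(it^{w_1},\dots,it^{w_k})$ for non-loops, $tp_{\mathtt s}(it):=l_s(it^{w_1},\dots,it^{w_k},it)$ and $lastIt_{\mathtt s}:=n_s(it^{w_1},\dots,it^{w_k})$ for loops; $start_{\mathtt s}:=tp_{\mathtt s}(0)$ if $\mathtt s$ is a loop, else $tp_{\mathtt s}$. Define $end_{\mathtt s}$ as: $start_{\mathtt s'}$ if $\mathtt s'$ follows $\mathtt s$ in the same statement sequence; $end_{\mathtt s'}$ if $\mathtt s$ is the last statement in the if- or else-branch of $\mathtt s'$; $tp_{\mathtt w}(\mathrm{succ}(it^{\mathtt w}))$ if $\mathtt s$ is the last statement of the body of loop $\mathtt w$; $l_{end}$ otherwise. Each integer variable $\mathtt v$ is a function $v:\mathbb L\times\mathbb T\to\mathbb I$, each array $\mathtt a$ a function $a:\mathbb L\times\mathbb I\times\mathbb T\to\mathbb I$; $[\![\mathtt e]\!](tp,tr)$ is the term obtained from expression $\mathtt e$ by replacing each variable by its value at $(tp,tr)$. Let $tr$ be a free variable of sort $\mathbb T$. $Eq(v,tp_1,tp_2)$ is $\forall pos_{\mathbb I}.\,v(tp_1,pos,tr)\simeq v(tp_2,pos,tr)$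 if $\mathtt v$ is an array and $v(tp_1,tr)\simeq v(tp_2,tr)$ otherwise; $EqAll(tp_1,tp_2):=\bigwedge_{v\in S_V}Eq(v,tp_1,tp_2)$. \textbf{Trace axioms.} $[\![\texttt{skip}]\!]:=\bigwedge_{v\in S_V}Eq(v,end_{\mathtt s},tp_{\mathtt s})$. For $\mathtt s=\mathtt{v=e}$: $v(end_{\mathtt s},tr)\simeq[\![\mathtt e]\!](tp_{\mathtt s},tr)\wedge\bigwedge_{v'\in S_V\setminus\{v\}}Eq(v',end_{\mathtt s},tp_{\mathtt s})$. For $\mathtt s=\mathtt{a[e_1]=e_2}$: $\forall pos_{\mathbb I}.(pos\not\simeq e_1(tp_{\mathtt s},tr)\to a(end_{\mathtt s},pos,tr)\simeq a(tp_{\mathtt s},pos,tr))\wedge a(end_{\mathtt s},e_1(tp_{\mathtt s},tr),tr)\simeq e_2(tp_{\mathtt s},tr)\wedge\bigwedge_{v\in S_V\setminus\{a\}}Eq(v,end_{\mathtt s},tp_{\mathtt s})$. For the conditional: $(C\to EqAll(start_{\mathtt{s_1}},tp_{\mathtt s}))\wedge(\neg C\to EqAll(start_{\mathtt{s'_1}},tp_{\mathtt s}))\wedge(C\to\bigwedge_i[\![\mathtt{s_i}]\!])\wedge(\neg C\to\bigwedge_i[\![\mathtt{s'_i}]\!])$ with $C=[\![\mathtt{Cond}]\!](tp_{\mathtt s},tr)$. For the loop $\mathtt s$: $\forall it^s_{\mathbb N}.(it^s<lastIt_{\mathtt s}\to[\![\mathtt{Cond}]\!](tp_{\mathtt s}(it^s),tr))\wedge\neg[\![\mathtt{Cond}]\!](tp_{\mathtt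 s}(lastIt_{\mathtt s}),tr)\wedge\forall it^s_{\mathbb N}.(it^s<lastIt_{\mathtt s}\to EqAll(start_{\mathtt{s_1}},tp_{\mathtt s}(it^s)))\wedge\forall it^s_{\mathbb N}.(it^s<lastIt_{\mathtt s}\to\bigwedge_i[\![\mathtt{s_i}]\!])\wedge EqAll(end_{\mathtt s},tp_{\mathtt s}(lastIt_{\mathtt s}))$. \textbf{Execution-interpretations.} Map ground timepoint terms to continuations by $R(tp_{\mathtt s}):=\mathtt s;R(end_{\mathtt s})$ for non-loops, $R(tp_{\mathtt s}(i)):=\mathtt s^{i};R(end_{\mathtt s})$ for loops (loop annotated with counter $i$), $R(l_{end}):=end$. An execution-interpretation of an execution $E$ is any interpretation $M$ (interpreting $\mathbb N$, $\mathbb I$ standardly) such that whenever a configuration $\langle R(tp),\sigma\rangle$ occurs in $E$, the term $v(tp,tr)$ is interpreted as $\sigma(\mathtt v)$ and $a(tp,pos,tr)$ as $\sigma(\mathtt a,pos)$.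
   Formalization: It is additionally assumed that M interprets lastIt_s as the iteration at which E finds the condition of a reached loop s false; without this the claim fails, e.g. for while(0=1){skip} with n_s interpreted as 5. *)

theory Defs
  imports Main
begin

type_synonym vname = string
type_synonym label = nat

datatype var = IntVar vname | ArrVar vname

datatype iexp =
    Num int
  | Var vname
  | Sel vname iexp
  | Add iexp iexp
  | Mul iexp iexp

datatype bexp =
    BConst bool
  | BEq iexp iexp
  | BLess iexp iexp
  | BNot bexp
  | BAnd bexp bexp
  | BOr bexp bexp

text \<open>
  Every statement carries a label that names the occurrence of the statement in the program; it is
  the index \<open>s\<close> of the symbols \<open>l\<^sub>s\<close> and \<open>n\<^sub>s\<close> and of the variable \<open>it\<^sup>s\<close>. The parameter \<open>'c\<close> is the
  annotation of loops: \<^typ>\<open>unit\<close> in programs, the counter of type \<^typ>\<open>nat\<close> in continuations.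
\<close>

datatype 'c stmt =
    Skip label
  | Assign label vname iexp
  | ArrAssign label vname iexp iexp
  | IfElse label bexp "'c stmt list" "'c stmt list"
  | While 'c label bexp "'c stmt list"

datatype program = Program (decls: "var list") (body: "unit stmt list")

fun lab :: "'c stmt \<Rightarrow> label" where
  "lab (Skip l) = l"
| "lab (Assign l x e) = l"
| "lab (ArrAssign l a e1 e2) = l"
| "lab (IfElse l c ss1 ss2) = l"
| "lab (While k l c ss) = l"

fun is_loop :: "'c stmt \<Rightarrow> bool" where
  "is_loop (While k l c ss) = True"
| "is_loop s = False"

fun labels :: "'c stmt \<Rightarrow> label list" where
  "labels (IfElse l c ss1 ss2) = l # concat (map labels ss1) @ concat (map labels ss2)"
| "labels (While k l c ss) = l # concat (map labels ss)"
| "labels s = [lab s]"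

fun iexp_vars :: "iexp \<Rightarrow> var set" where
  "iexp_vars (Num n) = {}"
| "iexp_vars (Var x) = {IntVar x}"
| "iexp_vars (Sel a e) = insert (ArrVar a) (iexp_vars e)"
| "iexp_vars (Add e1 e2) = iexp_vars e1 \<union> iexp_vars e2"
| "iexp_vars (Mul e1 e2) = iexp_vars e1 \<union> iexp_vars e2"

fun bexp_vars :: "bexp \<Rightarrow> var set" where
  "bexp_vars (BConst b) = {}"
| "bexp_vars (BEq e1 e2) = iexp_vars e1 \<union> iexp_vars e2"
| "bexp_vars (BLess e1 e2) = iexp_vars e1 \<union> iexp_vars e2"
| "bexp_vars (BNot c) = bexp_vars c"
| "bexp_vars (BAnd c1 c2) = bexp_vars c1 \<union> bexp_vars c2"
| "bexp_vars (BOr c1 c2) = bexp_vars c1 \<union> bexp_vars c2"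

fun stmt_vars :: "'c stmt \<Rightarrow> var set" where
  "stmt_vars (Skip l) = {}"
| "stmt_vars (Assign l x e) = insert (IntVar x) (iexp_vars e)"
| "stmt_vars (ArrAssign l a e1 e2) = insert (ArrVar a) (iexp_vars e1 \<union> iexp_vars e2)"
| "stmt_vars (IfElse l c ss1 ss2) =
     bexp_vars c \<union> (\<Union>s\<in>set ss1. stmt_vars s) \<union> (\<Union>s\<in>set ss2. stmt_vars s)"
| "stmt_vars (While k l c ss) = bexp_vars c \<union> (\<Union>s\<in>set ss. stmt_vars s)"

text \<open>Branches and loop bodies \<open>s\<^sub>1; \<dots>; s\<^sub>k\<close> have \<open>k \<ge> 1\<close>: the axioms below refer to \<open>start\<close> of \<open>s\<^sub>1\<close>.\<close>

fun nonempty_blocks :: "'c stmt \<Rightarrow> bool" where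
  "nonempty_blocks (IfElse l c ss1 ss2) \<longleftrightarrow>
     ss1 \<noteq> [] \<and> ss2 \<noteq> [] \<and> (\<forall>s\<in>set ss1. nonempty_blocks s) \<and> (\<forall>s\<in>set ss2. nonempty_blocks s)"
| "nonempty_blocks (While k l c ss) \<longleftrightarrow> ss \<noteq> [] \<and> (\<forall>s\<in>set ss. nonempty_blocks s)"
| "nonempty_blocks s \<longleftrightarrow> True"

definition wf_program :: "program \<Rightarrow> bool" where
  "wf_program p \<longleftrightarrow>
     distinct (concat (map labels (body p))) \<and>
     (\<forall>s\<in>set (body p). nonempty_blocks s \<and> stmt_vars s \<subseteq> set (decls p))"

record state =
  ints :: "vname \<Rightarrow> int"
  arrs :: "vname \<Rightarrow> int \<Rightarrow> int"

fun ieval :: "iexp \<Rightarrow> state \<Rightarrow> int" where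
  "ieval (Num n) \<sigma> = n"
| "ieval (Var x) \<sigma> = ints \<sigma> x"
| "ieval (Sel a e) \<sigma> = arrs \<sigma> a (ieval e \<sigma>)"
| "ieval (Add e1 e2) \<sigma> = ieval e1 \<sigma> + ieval e2 \<sigma>"
| "ieval (Mul e1 e2) \<sigma> = ieval e1 \<sigma> * ieval e2 \<sigma>"

fun beval :: "bexp \<Rightarrow> state \<Rightarrow> bool" where
  "beval (BConst b) \<sigma> \<longleftrightarrow> b"
| "beval (BEq e1 e2) \<sigma> \<longleftrightarrow> ieval e1 \<sigma> = ieval e2 \<sigma>"
| "beval (BLess e1 e2) \<sigma> \<longleftrightarrow> ieval e1 \<sigma> < ieval e2 \<sigma>"
| "beval (BNot c) \<sigma> \<longleftrightarrow> \<not> beval c \<sigma>"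
| "beval (BAnd c1 c2) \<sigma> \<longleftrightarrow> beval c1 \<sigma> \<and> beval c2 \<sigma>"
| "beval (BOr c1 c2) \<sigma> \<longleftrightarrow> beval c1 \<sigma> \<or> beval c2 \<sigma>"

text \<open>The empty list is the continuation \<open>end\<close>.\<close>

type_synonym continuation = "nat stmt list"
type_synonym config = "continuation \<times> state"

inductive step :: "config \<Rightarrow> config \<Rightarrow> bool" where
  step_skip: "step (Skip l # q, \<sigma>) (q, \<sigma>)"
| step_assign:
    "step (Assign l x e # q, \<sigma>) (q, \<sigma>\<lparr>ints := (ints \<sigma>)(x := ieval e \<sigma>)\<rparr>)"
| step_arr_assign:
    "step (ArrAssign l a e1 e2 # q, \<sigma>)
       (q, \<sigma>\<lparr>arrs := (arrs \<sigma>)(a := (arrs \<sigma> a)(ieval e1 \<sigma> := ieval e2 \<sigma>))\<rparr>)"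
| step_if_true: "beval c \<sigma> \<Longrightarrow> step (IfElse l c q1 q2 # q, \<sigma>) (q1 @ q, \<sigma>)"
| step_if_false: "\<not> beval c \<sigma> \<Longrightarrow> step (IfElse l c q1 q2 # q, \<sigma>) (q2 @ q, \<sigma>)"
| step_while_true:
    "beval c \<sigma> \<Longrightarrow> step (While i l c q1 # q, \<sigma>) (q1 @ While (Suc i) l c q1 # q, \<sigma>)"
| step_while_false: "\<not> beval c \<sigma> \<Longrightarrow> step (While i l c q1 # q, \<sigma>) (q, \<sigma>)"

text \<open>
  \<open>annotate i s\<close> is \<open>s\<^sup>i\<close>: the counter of \<open>s\<close> itself is \<open>i\<close> if \<open>s\<close> is a loop, and all loops nested
  in \<open>s\<close> have counter 0.
\<close>

definition annotate0 :: "unit stmt \<Rightarrow> nat stmt" where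
  "annotate0 = map_stmt (\<lambda>_. 0)"

fun annotate :: "nat \<Rightarrow> unit stmt \<Rightarrow> nat stmt" where
  "annotate i (While k l c ss) = While i l c (map annotate0 ss)"
| "annotate i s = annotate0 s"

definition initial_config :: "program \<Rightarrow> state \<Rightarrow> config" where
  "initial_config p \<sigma>0 = (map annotate0 (body p), \<sigma>0)"

definition execution :: "program \<Rightarrow> config list \<Rightarrow> bool" where
  "execution p E \<longleftrightarrow>
     E \<noteq> [] \<and> (\<exists>\<sigma>0. hd E = initial_config p \<sigma>0) \<and>
     (\<forall>j. Suc j < length E \<longrightarrow> step (E ! j) (E ! Suc j)) \<and>
     fst (last E) = []"

definition all_executions_terminate :: "program \<Rightarrow> bool" where
  "all_executions_terminate p \<longleftrightarrow>
     (\<forall>\<sigma>0. \<not> (\<exists>f :: nat \<Rightarrow> config. f 0 = initial_config p \<sigma>0 \<and> (\<forall>j. step (f j) (f (Suc j)))))"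

text \<open>Variables of each of the four sorts are named by natural numbers.\<close>

datatype nterm =
    NVar nat
  | NZero
  | NSucc nterm
  | NPred nterm
  | NLast label "nterm list" \<comment> \<open>the symbol \<open>n\<^sub>s\<close> applied to its arguments\<close>

datatype tpterm =
    LVar nat
  | LTime label "nterm list" \<comment> \<open>the symbol \<open>l\<^sub>s\<close> applied to its arguments\<close>
  | LEnd

datatype trterm = TVar nat

datatype iterm =
    IVar nat
  | INum int
  | IAdd iterm iterm
  | IMul iterm iterm
  | IVal vname tpterm trterm
  | IArr vname tpterm iterm trterm

datatype fm =
    NEq nterm nterm | NLess nterm nterm
  | IEq iterm iterm | ILess iterm iterm
  | LEq tpterm tpterm
  | TEq trterm trterm
  | FTrue | FNot fm | FAnd fm fm | FOr fm fm | FImp fm fm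
  | AllN nat fm | AllI nat fm | AllL nat fm | AllT nat fm
  | ExN nat fm | ExI nat fm | ExL nat fm | ExT nat fm

definition conj_list :: "fm list \<Rightarrow> fm" where
  "conj_list Fs = foldr FAnd Fs FTrue"

abbreviation it :: "label \<Rightarrow> nterm" where "it w \<equiv> NVar w"
abbreviation pos :: iterm where "pos \<equiv> IVar 0"
abbreviation tr :: trterm where "tr \<equiv> TVar 0"

fun numeral_nterm :: "nat \<Rightarrow> nterm" where
  "numeral_nterm 0 = NZero"
| "numeral_nterm (Suc i) = NSucc (numeral_nterm i)"

text \<open>Grounding: replace every variable of sort \<open>\<nat>\<close> by the numeral of its value.\<close>

fun ground_n :: "(nat \<Rightarrow> nat) \<Rightarrow> nterm \<Rightarrow> nterm" where
  "ground_n \<eta> (NVar x) = numeral_nterm (\<eta> x)"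
| "ground_n \<eta> NZero = NZero"
| "ground_n \<eta> (NSucc t) = NSucc (ground_n \<eta> t)"
| "ground_n \<eta> (NPred t) = NPred (ground_n \<eta> t)"
| "ground_n \<eta> (NLast l ts) = NLast l (map (ground_n \<eta>) ts)"

fun ground_tp :: "(nat \<Rightarrow> nat) \<Rightarrow> tpterm \<Rightarrow> tpterm" where
  "ground_tp \<eta> (LVar x) = LVar x"
| "ground_tp \<eta> (LTime l ts) = LTime l (map (ground_n \<eta>) ts)"
| "ground_tp \<eta> LEnd = LEnd"

text \<open>The domains of \<open>\<nat>\<close> and \<open>\<int>\<close> are standard, those of timepoints and traces are \<open>'l\<close> and \<open>'t\<close>.
  \<open>pred\<close> is totalised by \<open>pred 0 = 0\<close>; it does not occur in the trace axioms.\<close>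

record ('l, 't) interp =
  i_time :: "label \<Rightarrow> nat list \<Rightarrow> 'l"
  i_end :: 'l
  i_last :: "label \<Rightarrow> nat list \<Rightarrow> nat"
  i_var :: "vname \<Rightarrow> 'l \<Rightarrow> 't \<Rightarrow> int"
  i_arr :: "vname \<Rightarrow> 'l \<Rightarrow> int \<Rightarrow> 't \<Rightarrow> int"

record ('l, 't) assignment =
  a_nat :: "nat \<Rightarrow> nat"
  a_int :: "nat \<Rightarrow> int"
  a_time :: "nat \<Rightarrow> 'l"
  a_trace :: "nat \<Rightarrow> 't"

fun nval :: "('l, 't) interp \<Rightarrow> ('l, 't) assignment \<Rightarrow> nterm \<Rightarrow> nat" where
  "nval M \<beta> (NVar x) = a_nat \<beta> x"
| "nval M \<beta> NZero = 0"
| "nval M \<beta> (NSucc t) = Suc (nval M \<beta> t)"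
| "nval M \<beta> (NPred t) = nval M \<beta> t - 1"
| "nval M \<beta> (NLast l ts) = i_last M l (map (nval M \<beta>) ts)"

fun tpval :: "('l, 't) interp \<Rightarrow> ('l, 't) assignment \<Rightarrow> tpterm \<Rightarrow> 'l" where
  "tpval M \<beta> (LVar x) = a_time \<beta> x"
| "tpval M \<beta> (LTime l ts) = i_time M l (map (nval M \<beta>) ts)"
| "tpval M \<beta> LEnd = i_end M"

fun trval :: "('l, 't) assignment \<Rightarrow> trterm \<Rightarrow> 't" where
  "trval \<beta> (TVar x) = a_trace \<beta> x"

fun ival :: "('l, 't) interp \<Rightarrow> ('l, 't) assignment \<Rightarrow> iterm \<Rightarrow> int" where
  "ival M \<beta> (IVar x) = a_int \<beta> x"
| "ival M \<beta> (INum n) = n"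
| "ival M \<beta> (IAdd t1 t2) = ival M \<beta> t1 + ival M \<beta> t2"
| "ival M \<beta> (IMul t1 t2) = ival M \<beta> t1 * ival M \<beta> t2"
| "ival M \<beta> (IVal x t u) = i_var M x (tpval M \<beta> t) (trval \<beta> u)"
| "ival M \<beta> (IArr a t i u) = i_arr M a (tpval M \<beta> t) (ival M \<beta> i) (trval \<beta> u)"

fun sat :: "('l, 't) interp \<Rightarrow> ('l, 't) assignment \<Rightarrow> fm \<Rightarrow> bool" where
  "sat M \<beta> (NEq t1 t2) \<longleftrightarrow> nval M \<beta> t1 = nval M \<beta> t2"
| "sat M \<beta> (NLess t1 t2) \<longleftrightarrow> nval M \<beta> t1 < nval M \<beta> t2"
| "sat M \<beta> (IEq t1 t2) \<longleftrightarrow> ival M \<beta> t1 = ival M \<beta> t2"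
| "sat M \<beta> (ILess t1 t2) \<longleftrightarrow> ival M \<beta> t1 < ival M \<beta> t2"
| "sat M \<beta> (LEq t1 t2) \<longleftrightarrow> tpval M \<beta> t1 = tpval M \<beta> t2"
| "sat M \<beta> (TEq t1 t2) \<longleftrightarrow> trval \<beta> t1 = trval \<beta> t2"
| "sat M \<beta> FTrue \<longleftrightarrow> True"
| "sat M \<beta> (FNot F) \<longleftrightarrow> \<not> sat M \<beta> F"
| "sat M \<beta> (FAnd F G) \<longleftrightarrow> sat M \<beta> F \<and> sat M \<beta> G"
| "sat M \<beta> (FOr F G) \<longleftrightarrow> sat M \<beta> F \<or> sat M \<beta> G"
| "sat M \<beta> (FImp F G) \<longleftrightarrow> (sat M \<beta> F \<longrightarrow> sat M \<beta> G)"
| "sat M \<beta> (AllN x F) \<longleftrightarrow> (\<forall>d. sat M (\<beta>\<lparr>a_nat := (a_nat \<beta>)(x := d)\<rparr>) F)"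
| "sat M \<beta> (AllI x F) \<longleftrightarrow> (\<forall>d. sat M (\<beta>\<lparr>a_int := (a_int \<beta>)(x := d)\<rparr>) F)"
| "sat M \<beta> (AllL x F) \<longleftrightarrow> (\<forall>d. sat M (\<beta>\<lparr>a_time := (a_time \<beta>)(x := d)\<rparr>) F)"
| "sat M \<beta> (AllT x F) \<longleftrightarrow> (\<forall>d. sat M (\<beta>\<lparr>a_trace := (a_trace \<beta>)(x := d)\<rparr>) F)"
| "sat M \<beta> (ExN x F) \<longleftrightarrow> (\<exists>d. sat M (\<beta>\<lparr>a_nat := (a_nat \<beta>)(x := d)\<rparr>) F)"
| "sat M \<beta> (ExI x F) \<longleftrightarrow> (\<exists>d. sat M (\<beta>\<lparr>a_int := (a_int \<beta>)(x := d)\<rparr>) F)"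
| "sat M \<beta> (ExL x F) \<longleftrightarrow> (\<exists>d. sat M (\<beta>\<lparr>a_time := (a_time \<beta>)(x := d)\<rparr>) F)"
| "sat M \<beta> (ExT x F) \<longleftrightarrow> (\<exists>d. sat M (\<beta>\<lparr>a_trace := (a_trace \<beta>)(x := d)\<rparr>) F)"

text \<open>In the following, \<open>ws\<close> is the list of the labels of the enclosing loops of \<open>s\<close>, outermost first.\<close>

definition tp :: "label list \<Rightarrow> unit stmt \<Rightarrow> tpterm" where
  "tp ws s = LTime (lab s) (map it ws)"

definition tp_loop :: "label list \<Rightarrow> unit stmt \<Rightarrow> nterm \<Rightarrow> tpterm" where
  "tp_loop ws s t = LTime (lab s) (map it ws @ [t])"

definition lastIt :: "label list \<Rightarrow> unit stmt \<Rightarrow> nterm" where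
  "lastIt ws s = NLast (lab s) (map it ws)"

definition start :: "label list \<Rightarrow> unit stmt \<Rightarrow> tpterm" where
  "start ws s = (if is_loop s then tp_loop ws s NZero else tp ws s)"

text \<open>
  \<open>end_tp ws e rest\<close> is \<open>end\<^sub>s\<close> for a statement \<open>s\<close> that is followed by \<open>rest\<close> in its statement
  sequence, where \<open>e\<close> is \<open>end\<^sub>s\<close> for the last statement of that sequence.
\<close>

fun end_tp :: "label list \<Rightarrow> tpterm \<Rightarrow> unit stmt list \<Rightarrow> tpterm" where
  "end_tp ws e [] = e"
| "end_tp ws e (s' # rest) = start ws s'"

fun iexp_at :: "tpterm \<Rightarrow> iexp \<Rightarrow> iterm" where
  "iexp_at t (Num n) = INum n"
| "iexp_at t (Var x) = IVal x t tr"
| "iexp_at t (Sel a e) = IArr a t (iexp_at t e) tr"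
| "iexp_at t (Add e1 e2) = IAdd (iexp_at t e1) (iexp_at t e2)"
| "iexp_at t (Mul e1 e2) = IMul (iexp_at t e1) (iexp_at t e2)"

fun bexp_at :: "tpterm \<Rightarrow> bexp \<Rightarrow> fm" where
  "bexp_at t (BConst b) = (if b then FTrue else FNot FTrue)"
| "bexp_at t (BEq e1 e2) = IEq (iexp_at t e1) (iexp_at t e2)"
| "bexp_at t (BLess e1 e2) = ILess (iexp_at t e1) (iexp_at t e2)"
| "bexp_at t (BNot c) = FNot (bexp_at t c)"
| "bexp_at t (BAnd c1 c2) = FAnd (bexp_at t c1) (bexp_at t c2)"
| "bexp_at t (BOr c1 c2) = FOr (bexp_at t c1) (bexp_at t c2)"

fun Eq :: "var \<Rightarrow> tpterm \<Rightarrow> tpterm \<Rightarrow> fm" where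
  "Eq (IntVar x) t1 t2 = IEq (IVal x t1 tr) (IVal x t2 tr)"
| "Eq (ArrVar a) t1 t2 = AllI 0 (IEq (IArr a t1 pos tr) (IArr a t2 pos tr))"

definition EqAll :: "var list \<Rightarrow> tpterm \<Rightarrow> tpterm \<Rightarrow> fm" where
  "EqAll SV t1 t2 = conj_list (map (\<lambda>v. Eq v t1 t2) SV)"

text \<open>
  \<open>trace_axiom SV ws e s\<close> is the trace axiom of \<open>s\<close>, where \<open>ws\<close> lists the enclosing loops of \<open>s\<close> and
  \<open>e\<close> is \<open>end\<^sub>s\<close>; \<open>trace_axioms SV ws e ss\<close> lists the axioms of the statements of the sequence \<open>ss\<close>,
  where \<open>e\<close> belongs to its last statement.
\<close>

fun trace_axiom :: "var list \<Rightarrow> label list \<Rightarrow> tpterm \<Rightarrow> unit stmt \<Rightarrow> fm"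
and trace_axioms :: "var list \<Rightarrow> label list \<Rightarrow> tpterm \<Rightarrow> unit stmt list \<Rightarrow> fm list" where
  "trace_axiom SV ws e (Skip l) = EqAll SV e (tp ws (Skip l))"
| "trace_axiom SV ws e (Assign l x ex) =
    (let t = tp ws (Assign l x ex) in
     FAnd (IEq (IVal x e tr) (iexp_at t ex))
          (conj_list (map (\<lambda>v. Eq v e t) (filter (\<lambda>v. v \<noteq> IntVar x) SV))))"
| "trace_axiom SV ws e (ArrAssign l a e1 e2) =
    (let t = tp ws (ArrAssign l a e1 e2) in
     conj_list
      [AllI 0 (FImp (FNot (IEq pos (iexp_at t e1))) (IEq (IArr a e pos tr) (IArr a t pos tr))),
       IEq (IArr a e (iexp_at t e1) tr) (iexp_at t e2),
       conj_list (map (\<lambda>v. Eq v e t) (filter (\<lambda>v. v \<noteq> ArrVar a) SV))])"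
| "trace_axiom SV ws e (IfElse l c ss1 ss2) =
    (let t = tp ws (IfElse l c ss1 ss2); C = bexp_at t c in
     conj_list
      [FImp C (EqAll SV (start ws (hd ss1)) t),
       FImp (FNot C) (EqAll SV (start ws (hd ss2)) t),
       FImp C (conj_list (trace_axioms SV ws e ss1)),
       FImp (FNot C) (conj_list (trace_axioms SV ws e ss2))])"
| "trace_axiom SV ws e (While k l c ss) =
    (let s = While k l c ss; ws' = ws @ [l] in
     conj_list
      [AllN l (FImp (NLess (it l) (lastIt ws s)) (bexp_at (tp_loop ws s (it l)) c)),
       FNot (bexp_at (tp_loop ws s (lastIt ws s)) c),
       AllN l (FImp (NLess (it l) (lastIt ws s)) (EqAll SV (start ws' (hd ss)) (tp_loop ws s (it l)))),
       AllN l (FImp (NLess (it l) (lastIt ws s))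
         (conj_list (trace_axioms SV ws' (tp_loop ws s (NSucc (it l))) ss))),
       EqAll SV e (tp_loop ws s (lastIt ws s))])"
| "trace_axioms SV ws e [] = []"
| "trace_axioms SV ws e (s # ss) = trace_axiom SV ws (end_tp ws e ss) s # trace_axioms SV ws e ss"

definition program_axiom :: "program \<Rightarrow> fm" where
  "program_axiom p = conj_list (trace_axioms (decls p) [] LEnd (body p))"

text \<open>
  \<open>occurrence p s ws e K\<close>: \<open>s\<close> is a statement of \<open>p\<close> with enclosing loops \<open>ws\<close>, \<open>e\<close> is \<open>end\<^sub>s\<close>, and
  \<open>K\<close> is the context of quantifiers and guards under which the axiom of \<open>s\<close> stands in
  \<^term>\<open>program_axiom p\<close>. For instance, for \<open>s\<close> in the then-branch of a conditional in the body of a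
  top-level loop \<open>w\<close>, \<open>K F\<close> is \<open>\<forall>it\<^sup>w. it\<^sup>w < lastIt\<^sub>w \<longrightarrow> C \<longrightarrow> F\<close>.
\<close>

inductive occurrence ::
  "program \<Rightarrow> unit stmt \<Rightarrow> label list \<Rightarrow> tpterm \<Rightarrow> (fm \<Rightarrow> fm) \<Rightarrow> bool" for p where
  occ_main: "body p = xs @ s # ys \<Longrightarrow> occurrence p s [] (end_tp [] LEnd ys) (\<lambda>F. F)"
| occ_then: "occurrence p (IfElse l c (xs @ s # ys) ss2) ws e K \<Longrightarrow>
    occurrence p s ws (end_tp ws e ys)
      (\<lambda>F. K (FImp (bexp_at (tp ws (IfElse l c (xs @ s # ys) ss2)) c) F))"
| occ_else: "occurrence p (IfElse l c ss1 (xs @ s # ys)) ws e K \<Longrightarrow>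
    occurrence p s ws (end_tp ws e ys)
      (\<lambda>F. K (FImp (FNot (bexp_at (tp ws (IfElse l c ss1 (xs @ s # ys))) c)) F))"
| occ_body: "occurrence p w ws e K \<Longrightarrow> w = While k l c (xs @ s # ys) \<Longrightarrow>
    occurrence p s (ws @ [l]) (end_tp (ws @ [l]) (tp_loop ws w (NSucc (it l))) ys)
      (\<lambda>F. K (AllN l (FImp (NLess (it l) (lastIt ws w)) F)))"

text \<open>
  \<open>R p t q\<close>: the ground timepoint term \<open>t\<close> is mapped to the continuation \<open>q\<close>. The ground instances of
  the terms of a statement are given by the values \<open>\<eta>\<close> of the iteration variables.
\<close>

inductive R :: "program \<Rightarrow> tpterm \<Rightarrow> continuation \<Rightarrow> bool" for p where
  R_end: "R p LEnd []"
| R_nonloop: "occurrence p s ws e K \<Longrightarrow> \<not> is_loop s \<Longrightarrow> R p (ground_tp \<eta> e) q \<Longrightarrow>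
    R p (ground_tp \<eta> (tp ws s)) (annotate0 s # q)"
| R_loop: "occurrence p s ws e K \<Longrightarrow> is_loop s \<Longrightarrow> R p (ground_tp \<eta> e) q \<Longrightarrow>
    R p (ground_tp \<eta> (tp_loop ws s (numeral_nterm i))) (annotate i s # q)"

text \<open>
  The element \<open>\<tau>\<close> of the domain of traces is the trace of \<open>E\<close>. The timepoint terms \<open>t\<close> are ground, so
  that of \<open>\<beta>\<close> only the value of \<open>tr\<close> matters; \<open>pos\<close> ranges over all integers.
\<close>

definition execution_interpretation ::
  "program \<Rightarrow> config list \<Rightarrow> ('l, 't) interp \<Rightarrow> 't \<Rightarrow> bool" where
  "execution_interpretation p E M \<tau> \<longleftrightarrow>
     (\<forall>t q \<sigma> \<beta>. R p t q \<and> (q, \<sigma>) \<in> set E \<and> trval \<beta> tr = \<tau> \<longrightarrow>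
        (\<forall>x. IntVar x \<in> set (decls p) \<longrightarrow> ival M \<beta> (IVal x t tr) = ints \<sigma> x) \<and>
        (\<forall>a. ArrVar a \<in> set (decls p) \<longrightarrow>
           ival M \<beta> (IArr a t pos tr) = arrs \<sigma> a (ival M \<beta> pos)))"

text \<open>
  The symbols \<open>n\<^sub>s\<close> have their intended meaning in \<open>E\<close>: if \<open>E\<close> reaches the loop \<open>s\<close> at iteration \<open>i\<close>
  (for given iterations \<open>\<eta>\<close> of the enclosing loops) and the loop condition is false there, then
  \<open>lastIt\<^sub>s\<close> is interpreted as \<open>i\<close>. For arbitrary interpretations of \<open>n\<^sub>s\<close> the loop axioms are not
  sound: a loop with condition false has last iteration 0 in every execution.
\<close>

definition interprets_last_iterations ::
  "program \<Rightarrow> config list \<Rightarrow> ('l, 't) interp \<Rightarrow> bool" where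
  "interprets_last_iterations p E M \<longleftrightarrow>
     (\<forall>k l c ss ws e K \<eta> i q \<sigma> \<beta>.
        occurrence p (While k l c ss) ws e K \<and>
        R p (ground_tp \<eta> (tp_loop ws (While k l c ss) (numeral_nterm i))) q \<and>
        (q, \<sigma>) \<in> set E \<and> \<not> beval c \<sigma> \<longrightarrow>
        nval M \<beta> (ground_n \<eta> (lastIt ws (While k l c ss))) = i)"

end

theory Submission
  imports Defs
begin

text \<open>
  A finite execution that contains the configuration \<open>\<langle>q'; q, \<sigma>\<rangle>\<close> also contains some
  \<open>\<langle>q, \<sigma>'\<rangle>\<close>, because a step only ever replaces the first statement of a continuation. Hence, once the
  start of a statement sequence is reached, so is the start of each of its statements, and a loop
  runs through iterations \<open>0, \<dots>, n\<close> where its condition fails for the first time at \<open>n\<close>,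
  the value of \<open>lastIt\<close>. Soundness of each axiom at a reached statement follows by structural
  induction; an axiom in a context \<open>K\<close> is a consequence of \<open>program_axiom p\<close> because \<open>K\<close> is monotone.
\<close>

subsection \<open>Grounding\<close>

lemma nval_numeral_nterm [simp]: "nval M \<beta> (numeral_nterm n) = n"
  by (induction n) auto

lemma ground_n_numeral_nterm [simp]: "ground_n \<eta> (numeral_nterm n) = numeral_nterm n"
  by (induction n) auto

text \<open>\<open>R\<close> and the model conditions speak of ground terms, the axioms of open
  ones. Grounding by the values of the assignment itself joins the two.\<close>

lemma nval_ground_n [simp]: "nval M \<beta> (ground_n (a_nat \<beta>) t) = nval M \<beta> t"
  by (induction t) (auto simp: comp_def cong: map_cong)

lemma tpval_ground_tp [simp]: "tpval M \<beta> (ground_tp (a_nat \<beta>) t) = tpval M \<beta> t"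
  by (cases t) (auto simp: comp_def)

lemma nval_update_int [simp]: "nval M (\<beta>\<lparr>a_int := f\<rparr>) t = nval M \<beta> t"
  by (induction t) (auto cong: map_cong)

lemma tpval_update_int [simp]: "tpval M (\<beta>\<lparr>a_int := f\<rparr>) t = tpval M \<beta> t"
  by (cases t) (auto cong: map_cong)

section \<open>Iteration variables of terms\<close>

fun nvars :: "nterm \<Rightarrow> nat set" where
  "nvars (NVar x) = {x}"
| "nvars NZero = {}"
| "nvars (NSucc t) = nvars t"
| "nvars (NPred t) = nvars t"
| "nvars (NLast l ts) = (\<Union>t\<in>set ts. nvars t)"

fun tpvars :: "tpterm \<Rightarrow> nat set" where
  "tpvars (LTime l ts) = (\<Union>t\<in>set ts. nvars t)"
| "tpvars t = {}"

lemma ground_n_cong: "(\<And>x. x \<in> nvars t \<Longrightarrow> \<eta> x = \<eta>' x) \<Longrightarrow> ground_n \<eta> t = ground_n \<eta>' t"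
  by (induction t) auto

lemma ground_tp_cong: "(\<And>x. x \<in> tpvars t \<Longrightarrow> \<eta> x = \<eta>' x) \<Longrightarrow> ground_tp \<eta> t = ground_tp \<eta>' t"
  by (cases t) (auto intro!: ground_n_cong)

text \<open>Serves the quantifier over the variable of a loop: the end term of the loop does not
  mention it, so its ground instance is the same in every iteration.\<close>

lemma ground_tp_update: "x \<notin> tpvars t \<Longrightarrow> ground_tp (\<eta>(x := d)) t = ground_tp \<eta> t"
  by (rule ground_tp_cong) auto

lemma tpvars_start [simp]: "tpvars (start ws s) = set ws"
  by (auto simp: start_def tp_def tp_loop_def)

lemma tpvars_tp_loop [simp]: "tpvars (tp_loop ws s t) = set ws \<union> nvars t"
  by (auto simp: tp_loop_def)

lemma tpvars_end_tp: "tpvars e \<subseteq> set ws \<Longrightarrow> tpvars (end_tp ws e ss) \<subseteq> set ws"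
  by (cases ss) auto

lemma sat_conj_list [simp]: "sat M \<beta> (conj_list Fs) \<longleftrightarrow> (\<forall>F\<in>set Fs. sat M \<beta> F)"
  by (induction Fs) (auto simp: conj_list_def)

lemma annotate0_simps [simp]:
  "annotate0 (Skip l) = Skip l"
  "annotate0 (Assign l x e) = Assign l x e"
  "annotate0 (ArrAssign l a e1 e2) = ArrAssign l a e1 e2"
  "annotate0 (IfElse l c ss1 ss2) = IfElse l c (map annotate0 ss1) (map annotate0 ss2)"
  "annotate0 (While k l c ss) = While 0 l c (map annotate0 ss)"
  by (simp_all add: annotate0_def)

subsection \<open>Occurrences\<close>

lemma in_trace_axioms:
  "trace_axiom SV ws (end_tp ws e ys) s \<in> set (trace_axioms SV ws e (xs @ s # ys))"
  by (induction xs) auto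

lemma trace_axioms_memberE:
  assumes "F \<in> set (trace_axioms SV ws e ss)"
  obtains xs s ys where "ss = xs @ s # ys" "F = trace_axiom SV ws (end_tp ws e ys) s"
  using assms
proof (induction ss arbitrary: thesis)
  case Nil
  then show ?case by simp
next
  case (Cons a ss)
  show ?case
  proof (cases "F = trace_axiom SV ws (end_tp ws e ss) a")
    case True
    then show ?thesis using Cons.prems(1)[of "[]"] by simp
  next
    case False
    then have "F \<in> set (trace_axioms SV ws e ss)" using Cons.prems(2) by simp
    then obtain xs s ys where "ss = xs @ s # ys" "F = trace_axiom SV ws (end_tp ws e ys) s"
      using Cons.IH by blast
    then show ?thesis using Cons.prems(1)[of "a # xs"] by simp
  qed
qed

text \<open>The hole of \<open>K\<close> lies only in conclusions of implications and under
  universal quantifiers. The implication from \<open>F\<close> to \<open>G\<close> is asked for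
  every assignment because \<open>AllN\<close> changes the assignment on the way to the
  hole.\<close>

lemma occurrence_context_mono:
  assumes "occurrence p s ws e K" "\<And>\<beta>. sat M \<beta> F \<Longrightarrow> sat M \<beta> G" "sat M \<beta> (K F)"
  shows "sat M \<beta> (K G)"
  using assms
proof (induction arbitrary: F G rule: occurrence.induct)
  case (occ_then l c xs s ys ss2 ws e K)
  from occ_then.IH[OF _ occ_then.prems(2)] occ_then.prems(1) show ?case by simp
next
  case (occ_else l c ss1 xs s ys ws e K)
  from occ_else.IH[OF _ occ_else.prems(2)] occ_else.prems(1) show ?case by simp
next
  case (occ_body w ws e K k l c xs s ys)
  from occ_body.IH[OF _ occ_body.prems(2)] occ_body.prems(1) show ?case by simp
qed auto

text \<open>Pure logic, with no execution involved: the axiom of the enclosing statement implies the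
  guarded axiom of \<open>s\<close>, and monotonicity carries this through the context of the
  enclosing statement.\<close>

lemma program_axiom_imp_occurrence:
  assumes "occurrence p s ws e K" "sat M \<beta> (program_axiom p)"
  shows "sat M \<beta> (K (trace_axiom (decls p) ws e s))"
  using assms
proof (induction rule: occurrence.induct)
  case (occ_main xs s ys)
  then show ?case
    using in_trace_axioms[of "decls p" "[]" LEnd ys s xs]
    unfolding program_axiom_def sat_conj_list by metis
next
  case (occ_then l c xs s ys ss2 ws e K)
  let ?w = "IfElse l c (xs @ s # ys) ss2"
  have "sat M \<beta> (FImp (bexp_at (tp ws ?w) c) (trace_axiom (decls p) ws (end_tp ws e ys) s))"
    if "sat M \<beta> (trace_axiom (decls p) ws e ?w)" for \<beta>
    using that in_trace_axioms[of "decls p" ws e ys s xs]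
    unfolding trace_axiom.simps Let_def sat_conj_list list.set ball_simps sat.simps
    by blast
  then show ?case
    using occurrence_context_mono[OF occ_then.hyps] occ_then.IH[OF occ_then.prems] by blast
next
  case (occ_else l c ss1 xs s ys ws e K)
  let ?w = "IfElse l c ss1 (xs @ s # ys)"
  have "sat M \<beta> (FImp (FNot (bexp_at (tp ws ?w) c)) (trace_axiom (decls p) ws (end_tp ws e ys) s))"
    if "sat M \<beta> (trace_axiom (decls p) ws e ?w)" for \<beta>
    using that in_trace_axioms[of "decls p" ws e ys s xs]
    unfolding trace_axiom.simps Let_def sat_conj_list list.set ball_simps sat.simps
    by blast
  then show ?case
    using occurrence_context_mono[OF occ_else.hyps] occ_else.IH[OF occ_else.prems] by blast
next
  case (occ_body w ws e K k l c xs s ys)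
  let ?e' = "end_tp (ws @ [l]) (tp_loop ws w (NSucc (it l))) ys"
  have "sat M \<beta> (AllN l (FImp (NLess (it l) (lastIt ws w)) (trace_axiom (decls p) (ws @ [l]) ?e' s)))"
    if "sat M \<beta> (trace_axiom (decls p) ws e w)" for \<beta>
    using that in_trace_axioms[of "decls p" "ws @ [l]" "tp_loop ws w (NSucc (it l))" ys s xs]
    unfolding occ_body.hyps(2) trace_axiom.simps Let_def sat_conj_list list.set ball_simps sat.simps
    by blast
  then show ?case
    using occurrence_context_mono[OF occ_body.hyps(1)] occ_body.IH[OF occ_body.prems] by blast
qed

text \<open>Distinct labels make the variable of a loop fresh for the enclosing loops, hence by
  \<open>tpvars e \<subseteq> set ws\<close> also for its end term \<open>e\<close>. The loop axiom
  relies on this freshness.\<close>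

lemma occurrence_wf:
  assumes "occurrence p s ws e K" "wf_program p"
  shows "nonempty_blocks s \<and> stmt_vars s \<subseteq> set (decls p) \<and> tpvars e \<subseteq> set ws \<and>
    distinct (labels s) \<and> set ws \<inter> set (labels s) = {}"
  using assms
proof (induction rule: occurrence.induct)
  case (occ_main xs s ys)
  then show ?case using tpvars_end_tp[of LEnd "[]" ys] by (auto simp: wf_program_def)
next
  case (occ_body w ws e K k l c xs s ys)
  then show ?case
    using tpvars_end_tp[of "tp_loop ws w (NSucc (it l))" "ws @ [l]" ys] by auto
next
  case (occ_then l c xs s ys ss2 ws e K)
  then show ?case using tpvars_end_tp[of e ws ys] by auto
next
  case (occ_else l c ss1 xs s ys ws e K)
  then show ?case using tpvars_end_tp[of e ws ys] by auto
qed

subsection \<open>Reachability in an execution\<close>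

locale execution_of =
  fixes p :: program and E :: "config list"
  assumes exec: "execution p E"
begin

text \<open>Only the last configuration has no successor, and its continuation is empty.\<close>

lemma next_config:
  assumes "j < length E" "fst (E ! j) \<noteq> []"
  shows "Suc j < length E" "step (E ! j) (E ! Suc j)"
proof -
  have "fst (last E) = []" "E \<noteq> []" using exec by (auto simp: execution_def)
  then have "j \<noteq> length E - 1" using assms(2) by (auto simp: last_conv_nth)
  then show "Suc j < length E" using assms(1) by simp
  then show "step (E ! j) (E ! Suc j)" using exec by (simp add: execution_def)
qed

lemma next_config_mem:
  assumes "(s # q, \<sigma>) \<in> set E"
  obtains c where "c \<in> set E" "step (s # q, \<sigma>) c"
proof -
  from assms obtain j where j: "j < length E" "E ! j = (s # q, \<sigma>)"
    by (auto simp: in_set_conv_nth)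
  then show ?thesis using next_config[of j] by (intro that[of "E ! Suc j"]) auto
qed

lemma step_keeps_tail: "step (s # q, \<sigma>) (q', \<sigma>') \<Longrightarrow> \<exists>qs. q' = qs @ q"
  by (erule step.cases) auto

text \<open>Induction on the number of remaining configurations. The bound \<open>k \<ge> j\<close>
  lets \<open>loop_iterations_from\<close> resume at a strictly later index after the body.\<close>

lemma reaches_suffix_from:
  assumes "j < length E" "fst (E ! j) = qs @ q"
  shows "\<exists>k\<ge>j. k < length E \<and> fst (E ! k) = q"
  using assms
proof (induction "length E - j" arbitrary: j qs rule: less_induct)
  case less
  show ?case
  proof (cases qs)
    case Nil
    then show ?thesis using less.prems by auto
  next
    case (Cons s qs')
    then have n: "Suc j < length E" "step (E ! j) (E ! Suc j)"
      using next_config[of j] less.prems by auto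
    obtain \<sigma> where "E ! j = (s # qs' @ q, \<sigma>)"
      using less.prems Cons by (metis append_Cons prod.collapse)
    \<comment> \<open>The step replaces \<open>s\<close> only, so \<open>qs'\<close> and
      \<open>q\<close> stay at the end of the new continuation.\<close>
    then obtain qs'' where "fst (E ! Suc j) = (qs'' @ qs') @ q"
      using n(2) step_keeps_tail[of s "qs' @ q" \<sigma>] by (metis append.assoc prod.collapse)
    then have "\<exists>k\<ge>Suc j. k < length E \<and> fst (E ! k) = q"
      using less.hyps[of "Suc j"] n(1) by fastforce
    then show ?thesis using Suc_leD by blast
  qed
qed

lemma reaches_suffix:
  assumes "(qs @ q, \<sigma>) \<in> set E"
  obtains \<sigma>' where "(q, \<sigma>') \<in> set E"
proof -
  from assms obtain j where "j < length E" "fst (E ! j) = qs @ q"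
    by (auto simp: in_set_conv_nth)
  then obtain k where "k < length E" "fst (E ! k) = q"
    using reaches_suffix_from by blast
  then show ?thesis using that by (metis nth_mem prod.collapse)
qed

text \<open>The number \<open>n\<close> is the counter at which the loop is left; it exists because
  \<open>E\<close> is finite. The start counter \<open>i\<close> is general for the induction. A
  test keeps the state, so the same \<open>\<sigma>'\<close> appears at the test and right after
  it.\<close>

lemma loop_iterations_from:
  assumes "j < length E" "E ! j = (While i l c b # q, \<sigma>)"
  shows "\<exists>n\<ge>i.
    (\<forall>m. i \<le> m \<and> m < n \<longrightarrow> (\<exists>\<sigma>'. (While m l c b # q, \<sigma>') \<in> set E \<and> beval c \<sigma>' \<and>
       (b @ While (Suc m) l c b # q, \<sigma>') \<in> set E)) \<and>
    (\<exists>\<sigma>'. (While n l c b # q, \<sigma>') \<in> set E \<and> \<not> beval c \<sigma>' \<and> (q, \<sigma>') \<in> set E)"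
  using assms
proof (induction "length E - j" arbitrary: j i \<sigma> rule: less_induct)
  case less
  have n: "Suc j < length E" "step (While i l c b # q, \<sigma>) (E ! Suc j)"
    using next_config[of j] less.prems by auto
  have here: "(While i l c b # q, \<sigma>) \<in> set E"
    using less.prems by (metis nth_mem)
  show ?case
  proof (cases "beval c \<sigma>")
    case False
    with n(2) have "E ! Suc j = (q, \<sigma>)" by (auto elim: step.cases)
    then have "(q, \<sigma>) \<in> set E" using n(1) by (metis nth_mem)
    then show ?thesis using False here by (intro exI[of _ i]) auto
  next
    case True
    with n(2) have bj: "E ! Suc j = (b @ While (Suc i) l c b # q, \<sigma>)" by (auto elim: step.cases)
    then have body: "(b @ While (Suc i) l c b # q, \<sigma>) \<in> set E" using n(1) by (metis nth_mem)
    \<comment> \<open>After one run of the body the loop is met again with counter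
      \<open>Suc i\<close>, at an index beyond \<open>j\<close>, where the induction hypothesis
      applies.\<close>
    obtain k where k: "k \<ge> Suc j" "k < length E" "fst (E ! k) = While (Suc i) l c b # q"
      using reaches_suffix_from[OF n(1), of b] bj by auto
    then have less_k: "length E - k < length E - j" "E ! k = (While (Suc i) l c b # q, snd (E ! k))"
      by (auto simp: prod_eq_iff)
    obtain n where "n \<ge> Suc i" and
      n: "\<And>m. Suc i \<le> m \<Longrightarrow> m < n \<Longrightarrow> \<exists>\<sigma>'. (While m l c b # q, \<sigma>') \<in> set E \<and> beval c \<sigma>' \<and>
        (b @ While (Suc m) l c b # q, \<sigma>') \<in> set E"
      "\<exists>\<sigma>'. (While n l c b # q, \<sigma>') \<in> set E \<and> \<not> beval c \<sigma>' \<and> (q, \<sigma>') \<in> set E"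
      using less.hyps[of k "Suc i" "snd (E ! k)"] less_k k(2) by auto
    have "\<exists>\<sigma>'. (While m l c b # q, \<sigma>') \<in> set E \<and> beval c \<sigma>' \<and>
        (b @ While (Suc m) l c b # q, \<sigma>') \<in> set E" if "i \<le> m" "m < n" for m
      using that n(1)[of m] here body True by (cases "m = i") auto
    then show ?thesis using \<open>n \<ge> Suc i\<close> n(2) by (intro exI[of _ n]) auto
  qed
qed

lemma loop_iterations:
  assumes "(While 0 l c b # q, \<sigma>) \<in> set E"
  obtains n \<sigma>n where
    "\<forall>m<n. \<exists>\<sigma>'. (While m l c b # q, \<sigma>') \<in> set E \<and> beval c \<sigma>' \<and>
       (b @ While (Suc m) l c b # q, \<sigma>') \<in> set E"
    "(While n l c b # q, \<sigma>n) \<in> set E" "\<not> beval c \<sigma>n" "(q, \<sigma>n) \<in> set E"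
proof -
  obtain j where "j < length E" "E ! j = (While 0 l c b # q, \<sigma>)"
    using assms by (auto simp: in_set_conv_nth)
  from loop_iterations_from[OF this] show thesis using that by fastforce
qed

end

section \<open>Continuations at the starts of statement sequences\<close>

lemma R_start:
  assumes "occurrence p s ws e K" "R p (ground_tp \<eta> e) q"
  shows "R p (ground_tp \<eta> (start ws s)) (annotate0 s # q)"
proof (cases "is_loop s")
  case True
  \<comment> \<open>A loop starts at iteration 0, which is also the counter that
    \<open>annotate0\<close> gives it.\<close>
  then have "annotate 0 s = annotate0 s" by (cases s) auto
  then show ?thesis using R_loop[OF assms(1) True assms(2), of 0] True by (simp add: start_def)
next
  case False
  then show ?thesis using R_nonloop[OF assms(1) False assms(2)] by (simp add: start_def)
qed

text \<open>The context is hidden since \<open>R\<close> and \<open>axiom_sound\<close> ask only for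
  some \<open>K\<close>. Quantifying over all splits makes the property pass to tails of the
  sequence.\<close>

definition occurs_seq :: "program \<Rightarrow> label list \<Rightarrow> tpterm \<Rightarrow> unit stmt list \<Rightarrow> bool" where
  "occurs_seq p ws e ss \<longleftrightarrow>
     (\<forall>xs s ys. ss = xs @ s # ys \<longrightarrow> (\<exists>K. occurrence p s ws (end_tp ws e ys) K))"

text \<open>Built from the back: each statement puts itself in front of the continuation at its own
  end, which is the start of the next statement or \<open>e\<close>.\<close>

lemma R_end_tp:
  assumes "occurs_seq p ws e ss"
    and "R p (ground_tp \<eta> e) q"
  shows "R p (ground_tp \<eta> (end_tp ws e ss)) (map annotate0 ss @ q)"
  using assms
proof (induction ss)
  case (Cons s ss)
  have "occurs_seq p ws e ss"
    using Cons.prems(1) unfolding occurs_seq_def by (metis append_Cons)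
  then have "R p (ground_tp \<eta> (end_tp ws e ss)) (map annotate0 ss @ q)"
    using Cons.IH Cons.prems(2) by blast
  moreover obtain K where "occurrence p s ws (end_tp ws e ss) K"
    using Cons.prems(1) unfolding occurs_seq_def by (metis append_Nil)
  ultimately show ?case using R_start by simp
qed simp

subsection \<open>States stored at timepoints\<close>

locale execution_model = execution_of +
  fixes M :: "('l, 't) interp" and \<tau> :: 't
  assumes wf: "wf_program p"
    and interp: "execution_interpretation p E M \<tau>"
    and last_it: "interprets_last_iterations p E M"
begin

text \<open>Stated for elements of the domain of timepoints, not for terms, so that it passes from a
  ground term with a numeral to open terms of the same value, such as those with
  \<open>lastIt\<close>.\<close>

definition stores :: "'l \<Rightarrow> state \<Rightarrow> bool" where
  "stores d \<sigma> \<longleftrightarrow>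
     (\<forall>x. IntVar x \<in> set (decls p) \<longrightarrow> i_var M x d \<tau> = ints \<sigma> x) \<and>
     (\<forall>a z. ArrVar a \<in> set (decls p) \<longrightarrow> i_arr M a d z \<tau> = arrs \<sigma> a z)"

lemma stores_reached:
  assumes "R p (ground_tp (a_nat \<beta>) t) q" "(q, \<sigma>) \<in> set E"
  shows "stores (tpval M \<beta> t) \<sigma>"
proof -
  define t' where "t' = ground_tp (a_nat \<beta>) t"
  \<comment> \<open>\<open>execution_interpretation\<close> reads arrays only at \<open>pos\<close>.
    Giving \<open>pos\<close> the value \<open>z\<close> and letting \<open>z\<close> vary covers
    every cell; \<open>tr\<close> is sent to \<open>\<tau>\<close> whatever \<open>\<beta>\<close>
    does.\<close>
  define B where "B z = \<beta>\<lparr>a_int := \<lambda>_. z, a_trace := \<lambda>_. \<tau>\<rparr>" for z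
  have "nval M (B z) u = nval M \<beta> u" for z u
    by (induction u) (auto simp: B_def cong: map_cong)
  moreover have "a_time (B z) = a_time \<beta>" for z by (simp add: B_def)
  ultimately have "tpval M (B z) t' = tpval M \<beta> t" for z
    unfolding t'_def by (cases t) (auto cong: map_cong)
  moreover have "(\<forall>x. IntVar x \<in> set (decls p) \<longrightarrow> ival M (B z) (IVal x t' tr) = ints \<sigma> x) \<and>
    (\<forall>a. ArrVar a \<in> set (decls p) \<longrightarrow> ival M (B z) (IArr a t' pos tr) = arrs \<sigma> a (ival M (B z) pos))"
    for z
  proof -
    have "trval (B z) tr = \<tau>" by (simp add: B_def)
    then show ?thesis using interp assms
      unfolding execution_interpretation_def t'_def by blast
  qed
  ultimately show ?thesis by (auto simp: stores_def B_def)
qed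

section \<open>Equalities and program expressions evaluated at timepoints\<close>

lemma sat_Eq:
  assumes "trval \<beta> tr = \<tau>" "v \<in> set (decls p)" "stores (tpval M \<beta> t1) \<sigma>" "stores (tpval M \<beta> t2) \<sigma>"
  shows "sat M \<beta> (Eq v t1 t2)"
  by (cases v) (use assms in \<open>auto simp: stores_def\<close>)

lemma sat_EqAll:
  assumes "trval \<beta> tr = \<tau>" "stores (tpval M \<beta> t1) \<sigma>" "stores (tpval M \<beta> t2) \<sigma>"
  shows "sat M \<beta> (EqAll (decls p) t1 t2)"
  using sat_Eq[OF assms(1) _ assms(2,3)] by (auto simp: EqAll_def)

lemma ival_iexp_at:
  assumes "trval \<beta> tr = \<tau>" "stores (tpval M \<beta> t) \<sigma>" "iexp_vars ex \<subseteq> set (decls p)"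
  shows "ival M \<beta> (iexp_at t ex) = ieval ex \<sigma>"
  using assms(3) by (induction ex) (use assms(1,2) in \<open>auto simp: stores_def\<close>)

lemma sat_bexp_at:
  assumes "trval \<beta> tr = \<tau>" "stores (tpval M \<beta> t) \<sigma>" "bexp_vars c \<subseteq> set (decls p)"
  shows "sat M \<beta> (bexp_at t c) \<longleftrightarrow> beval c \<sigma>"
  using assms(3) by (induction c) (use ival_iexp_at[OF assms(1,2)] in auto)

subsection \<open>Soundness\<close>

text \<open>The axiom stands without its context: the guards are replaced by the condition that
  \<open>E\<close> reaches \<open>s\<close>, with \<open>a_nat \<beta>\<close> giving the
  iterations. Generality in \<open>\<beta>\<close>, \<open>ws\<close> and \<open>e\<close> lets the
  structural induction enter branches and loop bodies.\<close>

definition axiom_sound :: "unit stmt \<Rightarrow> bool" where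
  "axiom_sound s \<longleftrightarrow> (\<forall>ws e K q \<beta> \<sigma>.
     occurrence p s ws e K \<and> R p (ground_tp (a_nat \<beta>) e) q \<and> trval \<beta> tr = \<tau> \<and>
     (annotate0 s # q, \<sigma>) \<in> set E \<longrightarrow> sat M \<beta> (trace_axiom (decls p) ws e s))"

text \<open>Each statement of a reached sequence is itself reached: those in front of it run to
  completion, in some state \<open>\<sigma>'\<close>, and \<open>axiom_sound\<close> accepts any
  state.\<close>

lemma sat_trace_axioms:
  assumes sound: "\<And>s. s \<in> set ss \<Longrightarrow> axiom_sound s"
    and occ: "occurs_seq p ws e ss"
    and R: "R p (ground_tp (a_nat \<beta>) e) q"
    and tr: "trval \<beta> tr = \<tau>"
    and reached: "(map annotate0 ss @ q, \<sigma>) \<in> set E"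
    and F: "F \<in> set (trace_axioms (decls p) ws e ss)"
  shows "sat M \<beta> F"
proof -
  obtain xs s ys where ss: "ss = xs @ s # ys"
    and F: "F = trace_axiom (decls p) ws (end_tp ws e ys) s"
    using F by (rule trace_axioms_memberE)
  obtain K where "occurrence p s ws (end_tp ws e ys) K"
    using occ ss unfolding occurs_seq_def by blast
  moreover have "occurs_seq p ws e ys"
    using occ unfolding ss occurs_seq_def by (metis append.assoc append_Cons)
  then have "R p (ground_tp (a_nat \<beta>) (end_tp ws e ys)) (map annotate0 ys @ q)"
    using R_end_tp[OF _ R] by blast
  moreover obtain \<sigma>' where "(annotate0 s # map annotate0 ys @ q, \<sigma>') \<in> set E"
    using reaches_suffix[of "map annotate0 xs" "annotate0 s # map annotate0 ys @ q"] reached ss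
    by auto
  moreover have "axiom_sound s" using sound ss by simp
  ultimately show ?thesis
    using tr unfolding F axiom_sound_def by blast
qed

text \<open>Supplies the state at the entry of a branch or loop body, for the \<open>EqAll\<close>
  conjuncts there.\<close>

lemma stores_start_hd:
  assumes "occurs_seq p ws e ss"
    and "R p (ground_tp (a_nat \<beta>) e) q" "(map annotate0 ss @ q, \<sigma>) \<in> set E" "ss \<noteq> []"
  shows "stores (tpval M \<beta> (start ws (hd ss))) \<sigma>"
proof -
  have "end_tp ws e ss = start ws (hd ss)" using assms(4) by (cases ss) auto
  then show ?thesis using R_end_tp[OF assms(1,2)] assms(3) stores_reached by metis
qed

lemma stores_tp:
  assumes "occurrence p s ws e K" "\<not> is_loop s" "R p (ground_tp (a_nat \<beta>) e) q"
    "(annotate0 s # q, \<sigma>) \<in> set E"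
  shows "stores (tpval M \<beta> (tp ws s)) \<sigma>"
  using R_nonloop[OF assms(1-3)] assms(4) stores_reached by metis

section \<open>The axiom of each kind of statement\<close>

lemma axiom_sound_Skip: "axiom_sound (Skip l)"
  unfolding axiom_sound_def
proof (intro allI impI, elim conjE)
  fix ws e K q \<sigma> and \<beta> :: "('l, 't) assignment"
  assume prems: "occurrence p (Skip l) ws e K" "R p (ground_tp (a_nat \<beta>) e) q"
    "trval \<beta> tr = \<tau>" "(annotate0 (Skip l) # q, \<sigma>) \<in> set E"
  from prems(4) obtain c' where "c' \<in> set E" "step (annotate0 (Skip l) # q, \<sigma>) c'"
    by (rule next_config_mem)
  then have "(q, \<sigma>) \<in> set E" by (auto elim: step.cases)
  then show "sat M \<beta> (trace_axiom (decls p) ws e (Skip l))"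
    using prems(3) stores_reached[OF prems(2)] stores_tp[OF prems(1) _ prems(2,4)]
    by (auto intro!: sat_EqAll)
qed

text \<open>The step determines its result: \<open>tp\<close> stores the old state, \<open>e\<close>
  the updated one, and the axiom compares the two.\<close>

lemma axiom_sound_Assign: "axiom_sound (Assign l x ex)"
  unfolding axiom_sound_def
proof (intro allI impI, elim conjE)
  fix ws e K q \<sigma> and \<beta> :: "('l, 't) assignment"
  assume prems: "occurrence p (Assign l x ex) ws e K" "R p (ground_tp (a_nat \<beta>) e) q"
    "trval \<beta> tr = \<tau>" "(annotate0 (Assign l x ex) # q, \<sigma>) \<in> set E"
  define t where "t = tp ws (Assign l x ex)"
  define \<sigma>' where "\<sigma>' = \<sigma>\<lparr>ints := (ints \<sigma>)(x := ieval ex \<sigma>)\<rparr>"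
  from prems(4) obtain c' where "c' \<in> set E" "step (annotate0 (Assign l x ex) # q, \<sigma>) c'"
    by (rule next_config_mem)
  then have "(q, \<sigma>') \<in> set E" by (auto elim: step.cases simp: \<sigma>'_def)
  then have e: "stores (tpval M \<beta> e) \<sigma>'" using stores_reached[OF prems(2)] by simp
  have t: "stores (tpval M \<beta> t) \<sigma>"
    using stores_tp[OF prems(1) _ prems(2,4)] by (simp add: t_def)
  have vars: "IntVar x \<in> set (decls p)" "iexp_vars ex \<subseteq> set (decls p)"
    using occurrence_wf[OF prems(1) wf] by auto
  have "sat M \<beta> (IEq (IVal x e tr) (iexp_at t ex))"
    using e vars(1) prems(3) ival_iexp_at[OF prems(3) t vars(2)]
    by (auto simp: stores_def \<sigma>'_def)
  moreover have "sat M \<beta> (Eq v e t)" if "v \<in> set (decls p)" "v \<noteq> IntVar x" for v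
    by (cases v) (use that e t prems(3) in \<open>auto simp: stores_def \<sigma>'_def\<close>)
  ultimately show "sat M \<beta> (trace_axiom (decls p) ws e (Assign l x ex))" by (simp add: Let_def t_def)
qed

lemma axiom_sound_ArrAssign: "axiom_sound (ArrAssign l a e1 e2)"
  unfolding axiom_sound_def
proof (intro allI impI, elim conjE)
  fix ws e K q \<sigma> and \<beta> :: "('l, 't) assignment"
  assume prems: "occurrence p (ArrAssign l a e1 e2) ws e K" "R p (ground_tp (a_nat \<beta>) e) q"
    "trval \<beta> tr = \<tau>" "(annotate0 (ArrAssign l a e1 e2) # q, \<sigma>) \<in> set E"
  define t where "t = tp ws (ArrAssign l a e1 e2)"
  define \<sigma>' where "\<sigma>' = \<sigma>\<lparr>arrs := (arrs \<sigma>)(a := (arrs \<sigma> a)(ieval e1 \<sigma> := ieval e2 \<sigma>))\<rparr>"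
  from prems(4) obtain c'
    where "c' \<in> set E" "step (annotate0 (ArrAssign l a e1 e2) # q, \<sigma>) c'"
    by (rule next_config_mem)
  then have "(q, \<sigma>') \<in> set E" by (auto elim: step.cases simp: \<sigma>'_def)
  then have e: "stores (tpval M \<beta> e) \<sigma>'" using stores_reached[OF prems(2)] by simp
  have t: "stores (tpval M \<beta> t) \<sigma>"
    using stores_tp[OF prems(1) _ prems(2,4)] by (simp add: t_def)
  have vars: "ArrVar a \<in> set (decls p)"
    "iexp_vars e1 \<subseteq> set (decls p)" "iexp_vars e2 \<subseteq> set (decls p)"
    using occurrence_wf[OF prems(1) wf] by auto
  \<comment> \<open>The index term stands under the quantifier over \<open>pos\<close>, so its value
    must be known for every update of \<open>a_int\<close>.\<close>
  have "ival M (\<beta>\<lparr>a_int := f\<rparr>) (iexp_at t e1) = ieval e1 \<sigma>" for f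
    by (rule ival_iexp_at) (use prems(3) t vars in auto)
  then have "sat M \<beta> (AllI 0 (FImp (FNot (IEq pos (iexp_at t e1))) (IEq (IArr a e pos tr) (IArr a t pos tr))))"
    using e t vars(1) prems(3) by (auto simp: stores_def \<sigma>'_def)
  moreover have "sat M \<beta> (IEq (IArr a e (iexp_at t e1) tr) (iexp_at t e2))"
    using e vars(1) prems(3) ival_iexp_at[OF prems(3) t] vars(2,3)
    by (auto simp: stores_def \<sigma>'_def)
  moreover have "sat M \<beta> (Eq v e t)" if "v \<in> set (decls p)" "v \<noteq> ArrVar a" for v
    by (cases v) (use that e t prems(3) in \<open>auto simp: stores_def \<sigma>'_def\<close>)
  ultimately show "sat M \<beta> (trace_axiom (decls p) ws e (ArrAssign l a e1 e2))" by (simp add: Let_def t_def)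
qed

text \<open>Conjuncts for the branch not taken have a false premise. Entering the other branch keeps
  the state, so its start and \<open>tp\<close> store the same one.\<close>

lemma axiom_sound_IfElse:
  assumes "\<And>s. s \<in> set ss1 \<Longrightarrow> axiom_sound s" "\<And>s. s \<in> set ss2 \<Longrightarrow> axiom_sound s"
  shows "axiom_sound (IfElse l c ss1 ss2)"
  unfolding axiom_sound_def
proof (intro allI impI, elim conjE)
  fix ws e K q \<sigma> and \<beta> :: "('l, 't) assignment"
  assume prems: "occurrence p (IfElse l c ss1 ss2) ws e K" "R p (ground_tp (a_nat \<beta>) e) q"
    "trval \<beta> tr = \<tau>" "(annotate0 (IfElse l c ss1 ss2) # q, \<sigma>) \<in> set E"
  define t where "t = tp ws (IfElse l c ss1 ss2)"
  from prems(4) obtain c'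
    where c': "c' \<in> set E" "step (annotate0 (IfElse l c ss1 ss2) # q, \<sigma>) c'"
    by (rule next_config_mem)
  have t: "stores (tpval M \<beta> t) \<sigma>"
    using stores_tp[OF prems(1) _ prems(2,4)] by (simp add: t_def)
  have w: "ss1 \<noteq> []" "ss2 \<noteq> []" "bexp_vars c \<subseteq> set (decls p)"
    using occurrence_wf[OF prems(1) wf] by auto
  have C: "sat M \<beta> (bexp_at t c) \<longleftrightarrow> beval c \<sigma>"
    using sat_bexp_at[OF prems(3) t w(3)] .
  have occ1: "occurs_seq p ws e ss1"
    using prems(1) unfolding occurs_seq_def by (blast intro: occ_then)
  have occ2: "occurs_seq p ws e ss2"
    using prems(1) unfolding occurs_seq_def by (blast intro: occ_else)
  have branch: "sat M \<beta> (EqAll (decls p) (start ws (hd ss)) t)"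
    "\<And>F. F \<in> set (trace_axioms (decls p) ws e ss) \<Longrightarrow> sat M \<beta> F"
    if "(map annotate0 ss @ q, \<sigma>) \<in> set E" "ss \<noteq> []" "occurs_seq p ws e ss"
      "\<And>s. s \<in> set ss \<Longrightarrow> axiom_sound s" for ss
    using sat_EqAll[OF prems(3) stores_start_hd[OF that(3) prems(2) that(1,2)] t]
      sat_trace_axioms[OF that(4,3) prems(2,3) that(1)]
    by blast+
  show "sat M \<beta> (trace_axiom (decls p) ws e (IfElse l c ss1 ss2))"
  proof (cases "beval c \<sigma>")
    case True
    with c' have "(map annotate0 ss1 @ q, \<sigma>) \<in> set E" by (auto elim: step.cases)
    from branch[OF this w(1) occ1 assms(1)] show ?thesis
      using True C by (simp add: Let_def t_def)
  next
    case False
    with c' have "(map annotate0 ss2 @ q, \<sigma>) \<in> set E" by (auto elim: step.cases)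
    from branch[OF this w(2) occ2 assms(2)] show ?thesis
      using False C by (simp add: Let_def t_def)
  qed
qed

text \<open>Iterations below \<open>n\<close> yield the quantified conjuncts, and the failed test at
  iteration \<open>n\<close> yields the two about \<open>lastIt\<close>.\<close>

lemma axiom_sound_While:
  assumes "\<And>s. s \<in> set ss \<Longrightarrow> axiom_sound s"
  shows "axiom_sound (While k l c ss)"
  unfolding axiom_sound_def
proof (intro allI impI, elim conjE)
  fix ws e K q \<sigma> and \<beta> :: "('l, 't) assignment"
  assume prems: "occurrence p (While k l c ss) ws e K" "R p (ground_tp (a_nat \<beta>) e) q"
    "trval \<beta> tr = \<tau>" "(annotate0 (While k l c ss) # q, \<sigma>) \<in> set E"
  define s where "s = While k l c ss"
  define b where "b = map annotate0 ss"
  define ws' where "ws' = ws @ [l]"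
  define e' where "e' = tp_loop ws s (NSucc (it l))"
  note prems = prems[folded s_def]
  have w: "ss \<noteq> []" "bexp_vars c \<subseteq> set (decls p)" "l \<notin> tpvars e" "l \<notin> set ws"
    using occurrence_wf[OF prems(1) wf] by (auto simp: s_def)
  have Rloop: "R p (ground_tp \<eta> (tp_loop ws s (numeral_nterm i))) (While i l c b # q)"
    if "R p (ground_tp \<eta> e) q" for \<eta> i
    using R_loop[OF prems(1) _ that] by (simp add: s_def b_def)
  have "(While 0 l c b # q, \<sigma>) \<in> set E" using prems(4) by (simp add: s_def b_def)
  then obtain n \<sigma>n where
    iter: "\<forall>m<n. \<exists>\<sigma>'. (While m l c b # q, \<sigma>') \<in> set E \<and> beval c \<sigma>' \<and>
       (b @ While (Suc m) l c b # q, \<sigma>') \<in> set E"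
    and exit: "(While n l c b # q, \<sigma>n) \<in> set E" "\<not> beval c \<sigma>n" "(q, \<sigma>n) \<in> set E"
    by (rule loop_iterations)
  \<comment> \<open>Iteration \<open>n\<close> is reached with a false condition, which is the
    premise under which \<open>interprets_last_iterations\<close> fixes
    \<open>lastIt\<close>.\<close>
  have "nval M \<beta> (ground_n (a_nat \<beta>) (lastIt ws s)) = n"
    using last_it prems(1) Rloop[OF prems(2)] exit(1,2)
    unfolding interprets_last_iterations_def s_def by blast
  then have last: "nval M \<beta> (lastIt ws s) = n" by simp
  have "tpval M \<beta> (tp_loop ws s (lastIt ws s)) = tpval M \<beta> (tp_loop ws s (numeral_nterm n))"
    using last by (simp add: tp_loop_def)
  then have t_last: "stores (tpval M \<beta> (tp_loop ws s (lastIt ws s))) \<sigma>n"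
    using stores_reached[OF Rloop[OF prems(2)] exit(1)] by simp
  have iteration: "sat M \<beta>' (bexp_at (tp_loop ws s (it l)) c) \<and>
      sat M \<beta>' (EqAll (decls p) (start ws' (hd ss)) (tp_loop ws s (it l))) \<and>
      (\<forall>F\<in>set (trace_axioms (decls p) ws' e' ss). sat M \<beta>' F)"
    if d: "d < n" and \<beta>': "\<beta>' = \<beta>\<lparr>a_nat := (a_nat \<beta>)(l := d)\<rparr>" for d \<beta>'
  proof -
    obtain \<sigma>' where \<sigma>': "(While d l c b # q, \<sigma>') \<in> set E" "beval c \<sigma>'"
      "(b @ While (Suc d) l c b # q, \<sigma>') \<in> set E"
      using iter d by blast
    have tr: "trval \<beta>' tr = \<tau>" using prems(3) by (simp add: \<beta>')
    \<comment> \<open>By freshness of \<open>l\<close>, the continuation after the whole loop is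
      \<open>q\<close> in every iteration.\<close>
    have Re: "R p (ground_tp (a_nat \<beta>') e) q"
      using prems(2) w(3) by (simp add: \<beta>' ground_tp_update)
    have "tpval M \<beta>' (tp_loop ws s (it l)) = tpval M \<beta>' (tp_loop ws s (numeral_nterm d))"
      by (simp add: tp_loop_def \<beta>')
    then have t: "stores (tpval M \<beta>' (tp_loop ws s (it l))) \<sigma>'"
      using stores_reached[OF Rloop[OF Re] \<sigma>'(1)] by simp
    \<comment> \<open>The end of the body in iteration \<open>d\<close> is the loop itself at
      iteration \<open>Suc d\<close>; grounding turns \<open>NSucc (it l)\<close> into that
      numeral.\<close>
    have "ground_tp (a_nat \<beta>') e' = ground_tp (a_nat \<beta>') (tp_loop ws s (numeral_nterm (Suc d)))"
      by (simp add: e'_def tp_loop_def \<beta>')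
    then have Re': "R p (ground_tp (a_nat \<beta>') e') (While (Suc d) l c b # q)"
      using Rloop[OF Re] by metis
    have occ: "occurs_seq p ws' e' ss"
      using occ_body[OF prems(1)] unfolding occurs_seq_def ws'_def e'_def s_def by blast
    have reached: "(map annotate0 ss @ While (Suc d) l c b # q, \<sigma>') \<in> set E"
      using \<sigma>'(3) b_def by simp
    show ?thesis
      using sat_bexp_at[OF tr t w(2)] \<sigma>'(2)
        sat_EqAll[OF tr stores_start_hd[OF occ Re' reached w(1)] t]
        sat_trace_axioms[OF assms occ Re' tr reached]
      by blast
  qed
  \<comment> \<open>The arguments of \<open>lastIt\<close> are the enclosing iterations only, so the
    bound is constant under the quantifier over \<open>it l\<close>.\<close>
  have lastIt_upd: "nval M (\<beta>\<lparr>a_nat := (a_nat \<beta>)(l := d)\<rparr>) (lastIt ws s) = n" for d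
  proof -
    have "map (nval M (\<beta>\<lparr>a_nat := (a_nat \<beta>)(l := d)\<rparr>)) (map it ws) = map (nval M \<beta>) (map it ws)"
      using w(4) by auto
    then show ?thesis using last unfolding lastIt_def nval.simps by metis
  qed
  have "sat M \<beta> (FNot (bexp_at (tp_loop ws s (lastIt ws s)) c))"
    using sat_bexp_at[OF prems(3) t_last w(2)] exit(2) by simp
  moreover have "sat M \<beta> (EqAll (decls p) e (tp_loop ws s (lastIt ws s)))"
    by (rule sat_EqAll[OF prems(3) stores_reached[OF prems(2) exit(3)] t_last])
  ultimately show "sat M \<beta> (trace_axiom (decls p) ws e (While k l c ss))"
    using iteration unfolding trace_axiom.simps s_def Let_def
    unfolding s_def[symmetric] ws'_def[symmetric] e'_def[symmetric]
    by (simp add: lastIt_upd)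
qed

lemma axiom_sound: "axiom_sound s"
  by (induction s)
    (auto intro: axiom_sound_Skip axiom_sound_Assign axiom_sound_ArrAssign axiom_sound_IfElse
      axiom_sound_While)

text \<open>The first configuration of \<open>E\<close> is the start of the whole body, followed by
  the empty continuation of \<open>LEnd\<close>.\<close>

lemma program_axiom_sound:
  assumes "trval \<beta> tr = \<tau>"
  shows "sat M \<beta> (program_axiom p)"
proof -
  obtain \<sigma>0 where "hd E = (map annotate0 (body p), \<sigma>0)" "E \<noteq> []"
    using exec by (auto simp: execution_def initial_config_def)
  then have "(map annotate0 (body p) @ [], \<sigma>0) \<in> set E" by (metis append_Nil2 hd_in_set)
  moreover have "occurs_seq p [] LEnd (body p)"
    unfolding occurs_seq_def using occ_main by blast
  moreover have "R p (ground_tp (a_nat \<beta>) LEnd) []" by (simp add: R_end)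
  ultimately show ?thesis
    using sat_trace_axioms[OF axiom_sound] assms unfolding program_axiom_def sat_conj_list by blast
qed

end

theorem theorem1:
  fixes p :: program
    and E :: "config list"
    and M :: "('l, 't) interp"
    and \<tau> :: 't
  assumes "wf_program p"
    and "all_executions_terminate p"
    and "execution p E"
    and "execution_interpretation p E M \<tau>"
    and "interprets_last_iterations p E M"
  shows "(\<forall>s ws e K \<beta>. occurrence p s ws e K \<and> trval \<beta> tr = \<tau> \<longrightarrow>
            sat M \<beta> (K (trace_axiom (decls p) ws e s))) \<and>
         (\<forall>\<beta>. trval \<beta> tr = \<tau> \<longrightarrow> sat M \<beta> (program_axiom p))"
proof -
  interpret execution_model p E M \<tau>
    using assms by unfold_locales
  show ?thesis
    using program_axiom_sound program_axiom_imp_occurrence by blast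
qed

end
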